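(* For each integer $d\ge 0$, there exist $4^{d+1}$ pairwise disjoint Breaker pairing strategies for $\mathcal{Q}(4^{d+1},4^d+1)$, all of the same cardinality, whose union is the set of all edges of $Q_{4^{d+1}}$.
   Context: $Q_n$ is the hypercube graph on $\{0,1\}^n$ (vertices adjacent iff they differ in exactly one coordinate). A $k$-dimensional subcube of $Q_n$ is obtained by choosing $n-k$ coordinates and fixed values in $\{0,1\}$ for them, and taking all $2^k$ vectors agreeing with these fixed values. $\mathcal{Q}(n,k)$ is the hypergraph with vertex set $\{0,1\}^n$ whose edges are the $k$-dimensional subcubes of $Q_n$ (the Maker–Breaker game is played on it). Following the paper's convention, a Breaker pairing strategy for $\mathcal{Q}(n,k)$ is a matching $M$ in $Q_n$ (a set of pairwise disjoint edges) such that every $k$-dimensional subcube of $Q_n$ contains both endpoints of at least one edge of $M$. *)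

theory Defs
  imports Main "HOL-Library.FuncSet" "HOL-Library.Disjoint_Sets"
begin

definition cube_verts :: "nat \<Rightarrow> (nat \<Rightarrow> nat) set" where
  "cube_verts n = {..<n} \<rightarrow>\<^sub>E {0, 1}"

definition cube_edges :: "nat \<Rightarrow> (nat \<Rightarrow> nat) set set" where
  "cube_edges n = {{x, y} |x y. x \<in> cube_verts n \<and> y \<in> cube_verts n \<and>
     card {i \<in> {..<n}. x i \<noteq> y i} = 1}"

text \<open>
  \<open>I\<close> is the set of fixed coordinates and \<open>a\<close> gives their values. Writing \<open>card I + k = n\<close>
  instead of \<open>card I = n - k\<close> avoids truncated subtraction: there are no subcubes if \<open>k > n\<close>.
\<close>
definition subcubes :: "nat \<Rightarrow> nat \<Rightarrow> (nat \<Rightarrow> nat) set set" where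
  "subcubes n k = {{x \<in> cube_verts n. \<forall>i\<in>I. x i = a i} |I a.
     I \<subseteq> {..<n} \<and> card I + k = n \<and> a \<in> I \<rightarrow>\<^sub>E {0, 1}}"

definition cube_matching :: "nat \<Rightarrow> (nat \<Rightarrow> nat) set set \<Rightarrow> bool" where
  "cube_matching n M \<longleftrightarrow> M \<subseteq> cube_edges n \<and> disjoint M"

definition breaker_pairing_strategy :: "nat \<Rightarrow> nat \<Rightarrow> (nat \<Rightarrow> nat) set set \<Rightarrow> bool" where
  "breaker_pairing_strategy n k M \<longleftrightarrow>
     cube_matching n M \<and> (\<forall>C\<in>subcubes n k. \<exists>e\<in>M. e \<subseteq> C)"

end

theory Submission
  imports Defs "HOL-Library.Z2" "HOL-Library.Function_Algebras" "HOL-Library.Product_Plus"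
begin

text \<open>
  Label the \<open>n = 4\<^sup>m\<close> directions by the vectors \<open>b i\<close> of \<open>V = GF(4)\<^sup>m\<close> and give the edge at \<open>x\<close> in
  direction \<open>i\<close> the colour \<open>\<omega> (b i) + (\<Sum>j. x\<^sub>j (b i + b j))\<close>; as the term for \<open>j = i\<close> vanishes, this
  does not depend on \<open>x\<^sub>i\<close>. The colours in directions \<open>i\<close> and \<open>k\<close> at \<open>x\<close> differ by
  \<open>(\<omega> + \<Sum>j. x\<^sub>j) (b i + b k) \<noteq> 0\<close>, so each colour class is a perfect matching.
  In a subcube with free directions \<open>J\<close>, the colours in direction \<open>i \<in> J\<close> form a coset of the additive
  span \<open>W\<close> of the differences of the labels of \<open>J\<close>. Since \<open>\<bar>W\<bar> \<ge> \<bar>J\<bar> > \<bar>V\<bar> / 4\<close>, the index of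
  \<open>W\<close> in \<open>V\<close> is 1 or 2. Either two of the cosets obtained are distinct and then cover \<open>V\<close>, or \<open>W\<close> is
  closed under \<open>\<omega>\<close>, hence a \<open>GF(4)\<close>-subspace of index less than 4, so that \<open>W = V\<close>.
\<close>

section \<open>Coordinate flips and the edges of the cube\<close>

definition flip :: "nat \<Rightarrow> (nat \<Rightarrow> nat) \<Rightarrow> nat \<Rightarrow> nat" where
  "flip i x = x(i := 1 - x i)"

definition support :: "nat \<Rightarrow> (nat \<Rightarrow> nat) \<Rightarrow> nat set" where
  "support n x = {j. j < n \<and> x j = 1}"

lemma cube_verts_01: "x \<in> cube_verts n \<Longrightarrow> i < n \<Longrightarrow> x i = 0 \<or> x i = 1"
  unfolding cube_verts_def by auto

lemma cube_verts_ext: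
  assumes "x \<in> cube_verts n" "y \<in> cube_verts n" "\<And>i. i < n \<Longrightarrow> x i = y i"
  shows "x = y"
  using assms unfolding cube_verts_def by (metis PiE_ext lessThan_iff)

lemma flip_in_cube_verts: "x \<in> cube_verts n \<Longrightarrow> i < n \<Longrightarrow> flip i x \<in> cube_verts n"
  unfolding cube_verts_def flip_def by (auto simp: PiE_iff extensional_def)

lemma flip_flip: "x \<in> cube_verts n \<Longrightarrow> i < n \<Longrightarrow> flip i (flip i x) = x"
  using cube_verts_01[of x n i] unfolding flip_def by auto

lemma flip_neq: "flip i x i \<noteq> x i"
  unfolding flip_def by (cases "x i") auto

lemma flip_other: "j \<noteq> i \<Longrightarrow> flip i x j = x j"
  unfolding flip_def by auto

lemma flip_eq_iff: "flip i x = flip j x \<longleftrightarrow> i = j"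
  by (metis flip_neq flip_other)

lemma finite_support [simp]: "finite (support n x)"
  unfolding support_def by auto

lemma support_flip_diff: "support n (flip i x) - {i} = support n x - {i}"
  unfolding support_def flip_def by auto

lemma cube_edges_eq: "cube_edges n = {{x, flip i x} |x i. x \<in> cube_verts n \<and> i < n}"
proof (intro subset_antisym subsetI)
  fix e assume "e \<in> cube_edges n"
  then obtain x y where e: "e = {x, y}" and xy: "x \<in> cube_verts n" "y \<in> cube_verts n"
    and card: "card {i \<in> {..<n}. x i \<noteq> y i} = 1"
    unfolding cube_edges_def by blast
  obtain i where i: "{i \<in> {..<n}. x i \<noteq> y i} = {i}"
    using card card_1_singletonE by blast
  then have "i < n" by blast
  have "y = flip i x"
  proof (rule cube_verts_ext[OF xy(2) flip_in_cube_verts[OF xy(1) \<open>i < n\<close>]])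
    fix j assume "j < n"
    show "y j = flip i x j"
    proof (cases "j = i")
      case True
      have "x i \<noteq> y i" using i by blast
      then show ?thesis
        using True cube_verts_01[OF xy(1) \<open>i < n\<close>] cube_verts_01[OF xy(2) \<open>i < n\<close>]
        by (auto simp: flip_def)
    next
      case False
      then have "j \<notin> {i \<in> {..<n}. x i \<noteq> y i}" unfolding i by simp
      then show ?thesis using False \<open>j < n\<close> by (simp add: flip_other)
    qed
  qed
  then show "e \<in> {{x, flip i x} |x i. x \<in> cube_verts n \<and> i < n}"
    using e xy \<open>i < n\<close> by blast
next
  fix e assume "e \<in> {{x, flip i x} |x i. x \<in> cube_verts n \<and> i < n}"
  then obtain x i where e: "e = {x, flip i x}" and x: "x \<in> cube_verts n" "i < n" by blast
  have "x j \<noteq> flip i x j \<longleftrightarrow> j = i" for j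
    using flip_neq[of i x] flip_other[of j i x] by metis
  then have "{j \<in> {..<n}. x j \<noteq> flip i x j} = {i}"
    using x(2) by auto
  then have "card {j \<in> {..<n}. x j \<noteq> flip i x j} = 1" by simp
  then show "e \<in> cube_edges n"
    unfolding cube_edges_def using e x flip_in_cube_verts by blast
qed

section \<open>Finite vector spaces over GF(4) and their large additive subgroups\<close>

text \<open>In characteristic two, \<open>omega_omega\<close> makes \<open>\<omega>\<close> a root
  of t^2 + t + 1, so \<open>V\<close> is a vector space over GF(4).\<close>

locale quaternary_space =
  fixes V :: "'a::ab_group_add set" and \<omega> :: "'a \<Rightarrow> 'a"
  assumes double: "x + x = (0::'a)"
    and finite_V: "finite V"
    and zero_in: "0 \<in> V"
    and add_in: "x \<in> V \<Longrightarrow> y \<in> V \<Longrightarrow> x + y \<in> V"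
    and omega_in: "x \<in> V \<Longrightarrow> \<omega> x \<in> V"
    and omega_add: "\<omega> (x + y) = \<omega> x + \<omega> y"
    and omega_omega: "\<omega> (\<omega> x) = \<omega> x + x"
begin

lemma add_left_cancel2: "x + (x + y) = (y::'a)"
  by (metis add.assoc double add_0)

lemma add_eq_0_iff2: "x + y = 0 \<longleftrightarrow> x = (y::'a)"
  by (metis add_left_cancel double)

lemma sum_const: "finite A \<Longrightarrow> (\<Sum>j\<in>A. u) = (if odd (card A) then u else (0::'a))"
  by (induction A rule: finite_induct) (auto simp: double)

text \<open>Terms indexed by the intersection occur twice on the right and cancel.\<close>

lemma sum_sym_diff:
  fixes f :: "'b \<Rightarrow> 'a"
  assumes "finite A" "finite B"
  shows "sum f (A - B \<union> (B - A)) = sum f A + sum f B"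
proof -
  have "sum f A = sum f (A - B) + sum f (A \<inter> B)"
    using assms by (metis sum.Int_Diff add.commute)
  moreover have "sum f B = sum f (B - A) + sum f (A \<inter> B)"
    using assms by (metis sum.Int_Diff add.commute Int_commute)
  moreover have "sum f (A - B \<union> (B - A)) = sum f (A - B) + sum f (B - A)"
    using assms by (intro sum.union_disjoint) auto
  moreover have "(a + c) + (b + c) = a + b" for a b c :: 'a
    by (metis add.assoc add.commute add_left_cancel2)
  ultimately show ?thesis by simp
qed

text \<open>A subspace over GF(2) only; invariance under \<open>\<omega>\<close> is a separate
  condition.\<close>

definition subspace :: "'a set \<Rightarrow> bool" where
  "subspace W \<longleftrightarrow> W \<subseteq> V \<and> 0 \<in> W \<and> (\<forall>x\<in>W. \<forall>y\<in>W. x + y \<in> W)"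

lemma subspace_sum:
  assumes "subspace W" "\<And>j. j \<in> A \<Longrightarrow> f j \<in> W"
  shows "sum f A \<in> W"
  using assms(2) by (induction A rule: infinite_finite_induct)
    (use assms(1) in \<open>auto simp: subspace_def\<close>)

lemma subspace_V: "subspace V"
  by (simp add: subspace_def zero_in add_in)

text \<open>If the conclusion fails, \<open>W\<close> has four distinct cosets in \<open>V\<close>.\<close>
lemma large_subspace_meets:
  assumes W: "subspace W" and large: "card V < 4 * card W" and u: "u \<in> V" and v: "v \<in> V"
  shows "u \<in> W \<or> v \<in> W \<or> u + v \<in> W"
proof (rule ccontr)
  assume "\<not> ?thesis"
  then have notin: "u \<notin> W" "v \<notin> W" "u + v \<notin> W" by auto
  have W0: "0 \<in> W" and WV: "W \<subseteq> V" and Wadd: "\<And>x y. x \<in> W \<Longrightarrow> y \<in> W \<Longrightarrow> x + y \<in> W"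
    using W by (auto simp: subspace_def)
  let ?R = "{0, u, v, u + v}"
  have uv: "u \<noteq> v" using notin(3) W0 double by metis
  have "card ?R = 4"
    using notin W0 uv by (auto simp: card_insert_if)
  \<comment> \<open>\<open>?R\<close> is closed under addition and meets \<open>W\<close> only in 0,
    so its elements represent distinct cosets.\<close>
  have diff: "r + s \<in> ?R" if "r \<in> ?R" "s \<in> ?R" for r s
    using that by (auto simp: double add_left_cancel2 add.commute add.left_commute)
  have "inj_on (\<lambda>(r, w). r + w) (?R \<times> W)"
  proof (rule inj_onI, clarify)
    fix r w s z assume r: "r \<in> ?R" and s: "s \<in> ?R" and w: "w \<in> W" and z: "z \<in> W"
      and eq: "r + w = s + z"
    have "r + s = w + z"
      using eq by (metis add.assoc add.commute add_left_cancel2)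
    then have "r + s \<in> W" using Wadd w z by simp
    then have "r + s = 0" using diff[OF r s] notin by auto
    then have "r = s" by (simp add: add_eq_0_iff2)
    with eq show "r = s \<and> w = z" by simp
  qed
  then have "card ((\<lambda>(r, w). r + w) ` (?R \<times> W)) = card ?R * card W"
    by (simp add: card_image card_cartesian_product)
  moreover have "(\<lambda>(r, w). r + w) ` (?R \<times> W) \<subseteq> V"
    using u v WV by (auto intro!: add_in zero_in)
  ultimately show False
    using large finite_V \<open>card ?R = 4\<close> by (metis card_mono not_less)
qed

text \<open>One of \<open>v\<close>, \<open>\<alpha> v\<close> and
  \<open>\<alpha> (\<alpha> v) = \<alpha> v + v\<close> lies in \<open>W\<close>; invariance then
  yields \<open>v\<close>, as \<open>v = \<alpha> v + \<alpha> (\<alpha> v)\<close>.\<close>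

lemma large_invariant_subspace:
  assumes W: "subspace W" and large: "card V < 4 * card W" and "quaternary_space V \<alpha>"
    and inv: "\<And>x. x \<in> W \<Longrightarrow> \<alpha> x \<in> W"
  shows "W = V"
proof
  interpret alpha: quaternary_space V \<alpha> by fact
  have Wadd: "\<And>x y. x \<in> W \<Longrightarrow> y \<in> W \<Longrightarrow> x + y \<in> W"
    using W by (auto simp: subspace_def)
  show "W \<subseteq> V" using W by (auto simp: subspace_def)
  show "V \<subseteq> W"
  proof
    fix v assume v: "v \<in> V"
    have *: "v \<in> W" if "\<alpha> v \<in> W"
      using Wadd[OF that inv[OF that]] alpha.omega_omega[of v] add_left_cancel2 by simp
    have "\<alpha> v \<in> W" if "\<alpha> (\<alpha> v) \<in> W"
      using Wadd[OF that inv[OF that]] alpha.omega_omega[of "\<alpha> v"] add_left_cancel2 by simp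
    then show "v \<in> W"
      using large_subspace_meets[OF W large alpha.omega_in[OF v] v] * alpha.omega_omega[of v] by auto
  qed
qed

text \<open>Multiplication by \<open>\<omega>\<close> or by \<open>\<omega> + 1 = \<omega>\<^sup>2\<close>.\<close>
definition omega_plus :: "nat \<Rightarrow> 'a \<Rightarrow> 'a" where
  "omega_plus p x = \<omega> x + (if odd p then x else 0)"

text \<open>\<open>\<omega> + 1\<close> is the other root of t^2 + t + 1, so what holds for
  \<open>\<omega>\<close> applies to it too.\<close>

lemma quaternary_omega_plus: "quaternary_space V (omega_plus p)"
proof
  show "omega_plus p (x + y) = omega_plus p x + omega_plus p y" for x y
    by (simp add: omega_plus_def omega_add algebra_simps)
  show "omega_plus p (omega_plus p x) = omega_plus p x + x" for x
  proof (cases "odd p")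
    case True
    have "\<omega> x + x + \<omega> x + (\<omega> x + x) = \<omega> x + (x + x) + (\<omega> x + \<omega> x)"
      by (simp only: ac_simps)
    then show ?thesis
      using True by (simp add: omega_plus_def omega_add omega_omega double add.assoc)
  qed (simp add: omega_plus_def omega_omega)
qed (auto simp: double finite_V zero_in add_in omega_plus_def omega_in)

lemma omega_zero: "\<omega> 0 = 0"
  by (metis add_cancel_right_right omega_add)

lemma omega_eq_0: "\<omega> x = 0 \<Longrightarrow> x = 0"
  by (metis omega_zero omega_omega add_0)

end

section \<open>The edge colouring and its perfect matchings\<close>

locale labelled_quaternary_space = quaternary_space +
  fixes n :: nat and b :: "nat \<Rightarrow> 'a"
  assumes bij_b: "bij_betw b {..<n} V"
begin

definition colour :: "(nat \<Rightarrow> nat) \<Rightarrow> nat \<Rightarrow> 'a" where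
  "colour x i = \<omega> (b i) + (\<Sum>j\<in>support n x. b i + b j)"

definition colour_class :: "'a \<Rightarrow> (nat \<Rightarrow> nat) set set" where
  "colour_class v = {{x, flip i x} |x i. x \<in> cube_verts n \<and> i < n \<and> colour x i = v}"

lemma card_V: "card V = n"
  using bij_betw_same_card[OF bij_b] by simp

lemma b_in: "i < n \<Longrightarrow> b i \<in> V"
  using bij_betwE[OF bij_b] by auto

lemma b_inj: "i < n \<Longrightarrow> j < n \<Longrightarrow> b i = b j \<Longrightarrow> i = j"
  using bij_betw_imp_inj_on[OF bij_b] by (auto dest: inj_onD)

text \<open>The labels \<open>b j\<close> cancel, leaving \<open>card A\<close> copies of
  \<open>b i + b k\<close>, of which only the parity counts. \<open>A\<close> will be the support of
  a vertex or the fixed ones of a subcube.\<close>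

lemma shift_add:
  assumes "finite A"
  shows "(\<omega> (b i) + (\<Sum>j\<in>A. b i + b j)) + (\<omega> (b k) + (\<Sum>j\<in>A. b k + b j))
    = omega_plus (card A) (b i + b k)"
proof -
  have "(\<Sum>j\<in>A. b i + b j) + (\<Sum>j\<in>A. b k + b j) = (\<Sum>j\<in>A. (b i + b j) + (b k + b j))"
    by (simp add: sum.distrib)
  also have "\<dots> = (\<Sum>j\<in>A. b i + b k)"
    by (intro sum.cong refl) (metis add.assoc add.commute add_left_cancel2)
  also have "\<dots> = (if odd (card A) then b i + b k else 0)"
    by (rule sum_const[OF assms])
  finally show ?thesis
    by (simp only: omega_plus_def omega_add ac_simps)
qed

lemma colour_flip: "colour (flip i x) i = colour x i"
proof -
  have "(\<Sum>j\<in>support n y. b i + b j) = (\<Sum>j\<in>support n y - {i}. b i + b j)" for y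
    by (rule sum.mono_neutral_right) (auto simp: double)
  then show ?thesis
    unfolding colour_def by (metis support_flip_diff)
qed

lemma colour_in: "i < n \<Longrightarrow> colour x i \<in> V"
  unfolding colour_def
  by (intro add_in omega_in b_in subspace_sum[OF subspace_V]) (auto simp: support_def b_in)

lemma colour_inj:
  assumes "i < n" "k < n" "colour x i = colour x k"
  shows "i = k"
proof -
  \<comment> \<open>By \<open>shift_add\<close>, equal colours put \<open>b i + b k\<close> into the
    kernel of this map, which is trivial by \<open>omega_eq_0\<close>.\<close>
  interpret alpha: quaternary_space V "omega_plus (card (support n x))"
    by (rule quaternary_omega_plus)
  have "omega_plus (card (support n x)) (b i + b k) = 0"
    using assms(3) shift_add[of "support n x" i k]
    unfolding colour_def by (simp add: double)
  then have "b i + b k = 0" by (rule alpha.omega_eq_0)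
  then show ?thesis using b_inj assms by (simp add: add_eq_0_iff2)
qed

text \<open>The \<open>n\<close> directions at \<open>x\<close> have distinct colours in a set of
  size \<open>n\<close>.\<close>

lemma colour_surj:
  assumes "v \<in> V"
  obtains i where "i < n" "colour x i = v"
proof -
  have "inj_on (colour x) {..<n}" by (auto intro: inj_onI colour_inj)
  then have "card (colour x ` {..<n}) = card V" by (simp add: card_image card_V)
  then have "colour x ` {..<n} = V"
    using finite_V by (intro card_subset_eq) (auto simp: colour_in)
  then show thesis using assms that by auto
qed

text \<open>By \<open>colour_flip\<close>, either endpoint of an edge can serve as its base
  point.\<close>

lemma colour_class_at:
  assumes "e \<in> colour_class v" "z \<in> e"
  obtains i where "i < n" "z \<in> cube_verts n" "colour z i = v" "e = {z, flip i z}"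
proof -
  obtain x i where xi: "x \<in> cube_verts n" "i < n" "colour x i = v" "e = {x, flip i x}"
    using assms(1) unfolding colour_class_def by blast
  show thesis
  proof (cases "z = x")
    case False
    then have "z = flip i x" using assms(2) xi by auto
    then show thesis
      using that[of i] xi flip_in_cube_verts flip_flip colour_flip by (simp add: insert_commute)
  qed (use that xi in auto)
qed

text \<open>At \<open>z\<close> the direction determines, and is determined by, both the edge and
  its colour. The case \<open>v = w\<close> gives matchings, the case \<open>v \<noteq> w\<close>
  disjoint classes.\<close>

lemma colour_class_unique:
  assumes "e \<in> colour_class v" "f \<in> colour_class w" "z \<in> e" "z \<in> f"
  shows "e = f \<longleftrightarrow> v = w"
proof -
  obtain i where i: "i < n" "colour z i = v" "e = {z, flip i z}"
    by (rule colour_class_at[OF assms(1,3)])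
  obtain k where k: "k < n" "colour z k = w" "f = {z, flip k z}"
    by (rule colour_class_at[OF assms(2,4)])
  have "e = f \<longleftrightarrow> i = k"
    using i(3) k(3) flip_neq flip_eq_iff by (metis doubleton_eq_iff)
  then show ?thesis using i k colour_inj by blast
qed

lemma colour_class_nonempty_edge: "e \<in> colour_class v \<Longrightarrow> e \<noteq> {}"
  unfolding colour_class_def by auto

lemma cube_matching_colour_class: "cube_matching n (colour_class v)"
  unfolding cube_matching_def
proof
  show "colour_class v \<subseteq> cube_edges n"
    unfolding cube_edges_eq colour_class_def by blast
  show "disjoint (colour_class v)"
    by (rule disjointI) (use colour_class_unique in blast)
qed

lemma colour_class_disjoint:
  assumes "v \<noteq> w"
  shows "colour_class v \<inter> colour_class w = {}"
  using assms colour_class_unique colour_class_nonempty_edge by blast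

lemma Union_colour_class:
  assumes "v \<in> V"
  shows "\<Union>(colour_class v) = cube_verts n"
proof (intro subset_antisym subsetI)
  fix x assume "x \<in> cube_verts n"
  obtain i where "i < n" "colour x i = v" using colour_surj[OF assms] .
  with \<open>x \<in> cube_verts n\<close> show "x \<in> \<Union>(colour_class v)"
    unfolding colour_class_def by blast
qed (auto elim: colour_class_at)

lemma card_colour_class:
  assumes "v \<in> V"
  shows "2 * card (colour_class v) = card (cube_verts n)"
proof -
  have fin: "finite (cube_verts n)" unfolding cube_verts_def by (intro finite_PiE) auto
  have "2 * card (colour_class v) = card (\<Union>(colour_class v))"
  proof (rule card_partition)
    show "finite (\<Union>(colour_class v))" using fin Union_colour_class[OF assms] by simp
    then show "finite (colour_class v)" by (rule finite_UnionD)
    show "card e = 2" if "e \<in> colour_class v" for e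
    proof -
      obtain x i where "e = {x, flip i x}"
        using \<open>e \<in> colour_class v\<close> unfolding colour_class_def by blast
      moreover have "x \<noteq> flip i x" using flip_neq by metis
      ultimately show ?thesis by (metis card_2_iff)
    qed
    show "e \<inter> f = {}" if "e \<in> colour_class v" "f \<in> colour_class v" "e \<noteq> f" for e f
      using that colour_class_unique by blast
  qed
  then show ?thesis using Union_colour_class[OF assms] by simp
qed

lemma Union_colour_classes: "\<Union>(colour_class ` V) = cube_edges n"
proof (intro subset_antisym subsetI)
  fix e assume "e \<in> cube_edges n"
  then obtain x i where "x \<in> cube_verts n" "i < n" "e = {x, flip i x}"
    unfolding cube_edges_eq by blast
  then show "e \<in> \<Union>(colour_class ` V)"
    using colour_in[of i x] unfolding colour_class_def by blast
qed (use cube_matching_colour_class in \<open>auto simp: cube_matching_def\<close>)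

section \<open>Colours inside a subcube\<close>

text \<open>The GF(2)-span of the vectors \<open>b i + b j\<close>: over GF(2), linear combinations
  are subset sums.\<close>

definition differences :: "nat set \<Rightarrow> nat \<Rightarrow> 'a set" where
  "differences J i = (\<lambda>T. \<Sum>j\<in>T. b i + b j) ` Pow J"

text \<open>Symmetric differences of index sets realise addition, singletons give the generators,
  and these are distinct because \<open>b\<close> is injective.\<close>

lemma
  assumes J: "J \<subseteq> {..<n}" and i: "i \<in> J"
  shows subspace_differences: "subspace (differences J i)"
    and differences_generator: "j \<in> J \<Longrightarrow> b i + b j \<in> differences J i"
    and card_differences: "card J \<le> card (differences J i)"
proof -
  have fin: "finite T" if "T \<subseteq> J" for T
    by (rule finite_subset[OF subset_trans[OF that J] finite_lessThan])
  have bJ: "b j \<in> V" if "j \<in> J" for j using that J b_in by auto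
  show subspace: "subspace (differences J i)"
    unfolding subspace_def
  proof (intro conjI ballI)
    show "differences J i \<subseteq> V"
      unfolding differences_def
    proof (rule image_subsetI, rule subspace_sum[OF subspace_V])
      fix T j assume "T \<in> Pow J" "j \<in> T"
      then have "j \<in> J" by blast
      then show "b i + b j \<in> V" using add_in[OF bJ[OF i] bJ] by blast
    qed
    show "0 \<in> differences J i"
      unfolding differences_def by (rule image_eqI[where x = "{}"]) simp_all
    fix x y assume "x \<in> differences J i" "y \<in> differences J i"
    then obtain A B where AB: "A \<subseteq> J" "B \<subseteq> J"
      and xy: "x = (\<Sum>j\<in>A. b i + b j)" "y = (\<Sum>j\<in>B. b i + b j)"
      unfolding differences_def by blast
    have "x + y = (\<Sum>j\<in>A - B \<union> (B - A). b i + b j)"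
      using AB fin xy by (simp add: sum_sym_diff)
    then show "x + y \<in> differences J i"
      unfolding differences_def using AB by blast
  qed
  show gen: "b i + b j \<in> differences J i" if "j \<in> J" for j
    unfolding differences_def using that by (intro image_eqI[where x = "{j}"]) simp_all
  have "inj_on (\<lambda>j. b i + b j) J"
    by (rule inj_onI) (use J b_inj in \<open>simp add: subset_iff\<close>)
  moreover have "finite (differences J i)"
    unfolding differences_def using fin by auto
  ultimately show "card J \<le> card (differences J i)"
    by (intro card_inj_on_le) (use gen in auto)
qed

text \<open>Each generator \<open>b i + b j\<close> equals
  \<open>(b k + b i) + (b k + b j)\<close>.\<close>

lemma differences_subset:
  assumes "J \<subseteq> {..<n}" "i \<in> J" "k \<in> J"
  shows "differences J i \<subseteq> differences J k"
proof -
  have "b i + b j \<in> differences J k" if "j \<in> J" for j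
  proof -
    have "(b k + b i) + (b k + b j) \<in> differences J k"
      using subspace_differences[OF assms(1,3)] differences_generator[OF assms(1,3)] that assms(2)
      unfolding subspace_def by blast
    moreover have "(b k + b i) + (b k + b j) = b i + b j"
      by (metis add.assoc add.commute add_left_cancel2)
    ultimately show ?thesis by argo
  qed
  then show ?thesis
    unfolding differences_def[of J i]
    by (auto intro!: subspace_sum[OF subspace_differences[OF assms(1,3)]])
qed

text \<open>
  Within a subcube with free directions \<open>J\<close>, the colours in direction \<open>i \<in> J\<close> form a coset of
  \<open>differences J i\<close>, which does not depend on \<open>i\<close>. Here \<open>A\<close> is the set of fixed coordinates with
  value 1.
\<close>
lemma all_colours_in_cosets:
  assumes J: "J \<subseteq> {..<n}" and large: "n < 4 * card J" and v: "v \<in> V"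
    and A: "A \<subseteq> {..<n}"
  obtains i T where "i \<in> J" "T \<subseteq> J"
    "v = \<omega> (b i) + (\<Sum>j\<in>A. b i + b j) + (\<Sum>j\<in>T. b i + b j)"
proof -
  \<comment> \<open>The colour in direction \<open>i\<close> at the vertex with support
    \<open>A\<close>; \<open>v + c i \<in> ?W\<close> says that \<open>v\<close> lies in its
    coset.\<close>
  define c where "c i = \<omega> (b i) + (\<Sum>j\<in>A. b i + b j)" for i
  have fA: "finite A" using A finite_subset by blast
  obtain k where k: "k \<in> J" using large by (cases "J = {}") auto
  let ?W = "differences J k"
  let ?\<alpha> = "omega_plus (card A)"
  interpret alpha: quaternary_space V ?\<alpha> by (rule quaternary_omega_plus)
  have cV: "c i \<in> V" if "i \<in> J" for i
    unfolding c_def using that J A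
    by (intro add_in omega_in b_in subspace_sum[OF subspace_V]) (auto simp: b_in)
  have W: "subspace ?W" by (rule subspace_differences[OF J k])
  have cardW: "card V < 4 * card ?W"
    using large card_differences[OF J k] by (simp add: card_V)
  have "\<exists>i\<in>J. v + c i \<in> ?W"
  \<comment> \<open>Since \<open>c k + c i = ?\<alpha> (b k + b i)\<close>, this asks whether all
    \<open>c i\<close> lie in one coset of \<open>?W\<close>.\<close>
  proof (cases "\<forall>i\<in>J. ?\<alpha> (b k + b i) \<in> ?W")
    case True
    \<comment> \<open>By additivity, invariance passes from the generators to all of
      \<open>?W\<close>.\<close>
    have "?\<alpha> (\<Sum>j\<in>T. b k + b j) = (\<Sum>j\<in>T. ?\<alpha> (b k + b j))" if "finite T" for T
      using that by induction (auto simp: alpha.omega_zero alpha.omega_add)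
    then have "?\<alpha> (\<Sum>j\<in>T. b k + b j) \<in> ?W" if "T \<subseteq> J" for T
      using that True J finite_subset[of T "{..<n}"] subspace_sum[OF W, of T "\<lambda>j. ?\<alpha> (b k + b j)"]
      by auto
    then have "?\<alpha> x \<in> ?W" if "x \<in> ?W" for x
      using that unfolding differences_def by blast
    then have "?W = V"
      by (rule large_invariant_subspace[OF W cardW quaternary_omega_plus])
    then show ?thesis using k v cV add_in by blast
  next
    case False
    then obtain i where i: "i \<in> J" "?\<alpha> (b k + b i) \<notin> ?W" by blast
    have sh: "c k + c i = ?\<alpha> (b k + b i)"
      unfolding c_def by (rule shift_add[OF fA])
    \<comment> \<open>The first alternative is excluded by the choice of \<open>i\<close>; the
      others put \<open>v\<close> in the coset of \<open>c k\<close> or of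
      \<open>c i\<close>.\<close>
    have "c k + c i \<in> ?W \<or> v + c k \<in> ?W \<or> (c k + c i) + (v + c k) \<in> ?W"
      using i k v cV by (intro large_subspace_meets[OF W cardW] add_in) auto
    moreover have "(c k + c i) + (v + c k) = v + c i"
      by (metis add.assoc add.commute add_left_cancel2)
    ultimately show ?thesis using i k sh by metis
  qed
  then obtain i where i: "i \<in> J" "v + c i \<in> ?W" by blast
  then have "v + c i \<in> differences J i"
    using differences_subset[OF J k i(1)] by blast
  then obtain T where T: "T \<subseteq> J" "v + c i = (\<Sum>j\<in>T. b i + b j)"
    unfolding differences_def by blast
  have "v = c i + (v + c i)" by (metis add.commute add_left_cancel2)
  also have "\<dots> = c i + (\<Sum>j\<in>T. b i + b j)" unfolding T(2) by (rule refl)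
  finally show thesis using that[OF i(1) T(1)] unfolding c_def by blast
qed

lemma colour_class_meets_subcube:
  assumes v: "v \<in> V" and large: "n < 4 * k" and C: "C \<in> subcubes n k"
  shows "\<exists>e\<in>colour_class v. e \<subseteq> C"
proof -
  obtain I a where C_eq: "C = {x \<in> cube_verts n. \<forall>i\<in>I. x i = a i}"
    and I: "I \<subseteq> {..<n}" "card I + k = n" and a: "a \<in> I \<rightarrow>\<^sub>E {0, 1}"
    using C unfolding subcubes_def by blast
  define J where "J = {..<n} - I"
  define A where "A = {j \<in> I. a j = 1}"
  have "card J = k"
    using I finite_subset[OF I(1)] unfolding J_def by (simp add: card_Diff_subset)
  have JA: "J \<subseteq> {..<n}" "A \<subseteq> {..<n}" "n < 4 * card J"
    using I large \<open>card J = k\<close> by (auto simp: J_def A_def)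
  obtain i T where i: "i \<in> J" and T: "T \<subseteq> J"
    and v_eq: "v = \<omega> (b i) + (\<Sum>j\<in>A. b i + b j) + (\<Sum>j\<in>T. b i + b j)"
    by (rule all_colours_in_cosets[OF JA(1,3) v JA(2)])
  \<comment> \<open>The vertex agrees with \<open>a\<close> on \<open>I\<close>, and
    \<open>T\<close> lists its free coordinates with value 1. As \<open>i\<close> is free, flipping
    it stays in \<open>C\<close>.\<close>
  define x :: "nat \<Rightarrow> nat"
    where "x j = (if j < n then if j \<in> A \<union> T then 1 else 0 else undefined)" for j
  have x: "x \<in> cube_verts n"
    unfolding cube_verts_def x_def by (auto simp: PiE_iff extensional_def)
  have "support n x = A \<union> T"
    using JA T by (auto simp: support_def x_def)
  moreover have "finite A" "finite T" "A \<inter> T = {}"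
    using JA T finite_subset[OF _ finite_lessThan[of n]] by (blast, blast, auto simp: A_def J_def)
  ultimately have "colour x i = v"
    by (simp add: colour_def v_eq sum.union_disjoint add.assoc)
  moreover have "i < n" "i \<notin> I" using i by (auto simp: J_def)
  moreover have "x j = a j" if "j \<in> I" for j
    using that a I T by (auto simp: x_def A_def J_def PiE_iff)
  ultimately have "{x, flip i x} \<in> colour_class v" "{x, flip i x} \<subseteq> C"
    using x flip_in_cube_verts[OF x] flip_other[of _ i x]
    by (auto simp: colour_class_def C_eq) metis
  then show ?thesis by blast
qed

section \<open>The colour classes as pairing strategies\<close>

lemma disjoint_strategies:
  assumes "n < 4 * k"
  shows "\<exists>S :: (nat \<Rightarrow> nat) set set set.
    card S = n \<and>
    (\<forall>M\<in>S. breaker_pairing_strategy n k M) \<and>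
    disjoint S \<and>
    (\<forall>M\<in>S. \<forall>M'\<in>S. card M = card M') \<and>
    \<Union>S = cube_edges n"
proof (intro exI conjI ballI)
  let ?S = "colour_class ` V"
  \<comment> \<open>Disjoint classes are distinct sets only if nonempty; this is needed to count
    them.\<close>
  have "cube_verts n \<noteq> {}"
    unfolding cube_verts_def by (auto simp: PiE_eq_empty_iff)
  then have "colour_class v \<noteq> {}" if "v \<in> V" for v
    using Union_colour_class[OF that] by auto
  then have "inj_on colour_class V"
    using colour_class_disjoint by (metis inf.idem inj_onI)
  then show "card ?S = n" by (simp add: card_image card_V)
  show "disjoint ?S"
  proof (rule disjointI)
    show "M \<inter> M' = {}" if "M \<in> ?S" "M' \<in> ?S" "M \<noteq> M'" for M M'
      using that colour_class_disjoint by (elim imageE) metis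
  qed
  show "\<Union>?S = cube_edges n" by (rule Union_colour_classes)
  show "breaker_pairing_strategy n k M" if "M \<in> ?S" for M
    using that cube_matching_colour_class colour_class_meets_subcube[OF _ assms]
    unfolding breaker_pairing_strategy_def by blast
  show "card M = card M'" if "M \<in> ?S" "M' \<in> ?S" for M M'
  proof -
    have "2 * card M = 2 * card M'" using that card_colour_class by (elim imageE) simp
    then show ?thesis by simp
  qed
qed

end

section \<open>A concrete model of GF(4)^m\<close>

text \<open>Vectors of length \<open>m\<close> are padded with zeros, so that the pointwise addition
  of functions applies.\<close>

definition bit_vectors :: "nat \<Rightarrow> (nat \<Rightarrow> bit) set" where
  "bit_vectors m = {f. \<forall>i\<ge>m. f i = 0}"

lemma card_bit_vectors: "finite (bit_vectors m)" "card (bit_vectors m) = 2 ^ m"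
proof -
  have "bij_betw (\<lambda>f. {i. f i = 1}) (bit_vectors m) (Pow {..<m})"
  proof (rule bij_betw_byWitness[where f' = "\<lambda>A i. if i \<in> A then 1 else 0"])
    show "(\<lambda>f. {i. f i = 1}) ` bit_vectors m \<subseteq> Pow {..<m}"
      by (auto simp: bit_vectors_def) (metis not_less zero_neq_one)
  qed (auto simp: bit_vectors_def fun_eq_iff)
  then show "finite (bit_vectors m)" "card (bit_vectors m) = 2 ^ m"
    by (simp_all add: bij_betw_finite bij_betw_same_card card_Pow)
qed

text \<open>The pair \<open>(f, g)\<close> stands for \<open>f + \<omega> g\<close> in \<open>GF(4)\<^sup>m\<close>.\<close>
lemma quaternary_bit_vectors:
  "quaternary_space (bit_vectors m \<times> bit_vectors m) (\<lambda>(f, g). (g, f + g))"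
proof
  have bit_double: "x + x = 0" for x :: bit by (cases x) auto
  then have fun_double: "f + f = 0" for f :: "nat \<Rightarrow> bit" by (simp add: fun_eq_iff)
  then show "x + x = 0" for x :: "(nat \<Rightarrow> bit) \<times> (nat \<Rightarrow> bit)"
    by (cases x) (simp add: zero_prod_def)
  show "finite (bit_vectors m \<times> bit_vectors m)" by (simp add: card_bit_vectors)
qed (auto simp: bit_vectors_def zero_prod_def split: prod.splits)

theorem theorem5:
  fixes d :: nat
  shows "\<exists>S :: (nat \<Rightarrow> nat) set set set.
    card S = 4 ^ (d + 1) \<and>
    (\<forall>M\<in>S. breaker_pairing_strategy (4 ^ (d + 1)) (4 ^ d + 1) M) \<and>
    disjoint S \<and>
    (\<forall>M\<in>S. \<forall>M'\<in>S. card M = card M') \<and>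
    \<Union>S = cube_edges (4 ^ (d + 1))"
proof -
  let ?V = "bit_vectors (d + 1) \<times> bit_vectors (d + 1)"
  \<comment> \<open>The map is multiplication by \<open>\<omega>\<close>: \<omega> (f + \<omega> g)
    = g + \<omega> (f + g).\<close>
  interpret quaternary_space ?V "\<lambda>(f, g). (g, f + g)" by (rule quaternary_bit_vectors)
  have "card ?V = (2 * 2) ^ (d + 1)"
    unfolding power_mult_distrib by (simp add: card_bit_vectors card_cartesian_product)
  then obtain b where "bij_betw b {..<(4::nat) ^ (d + 1)} ?V"
    using finite_same_card_bij[of "{..<(4::nat) ^ (d + 1)}" ?V] finite_V by auto
  then interpret labelled_quaternary_space ?V "\<lambda>(f, g). (g, f + g)" "4 ^ (d + 1)" b
    by unfold_locales
  \<comment> \<open>The \<open>+ 1\<close> in the dimension makes the inequality strict, which rules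
    out index 4.\<close>
  show ?thesis by (rule disjoint_strategies) simp
qed

end
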